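(* Let $(\widetilde{\mathbf m}_h^n,\mathbf m_h^n)_{0\le n\le N}$ be the solution of the scheme (S) defined in the context, and let $\mathbf m$ be the exact solution of the harmonic map heat flow problem (HMF) of the context (with $\mathbf m(\cdot,t)$ continuous on $\overline\Omega$ and $|\mathbf m|=1$). For $0\le n\le N-1$ the auxiliary error $\widetilde{\mathbf e}_h^{n+1}=I_h\mathbf m(\cdot,t_{n+1})-\widetilde{\mathbf m}_h^{n+1}$ and the projected error $\mathbf e_h^{n+1}=I_h\mathbf m(\cdot,t_{n+1})-\mathbf m_h^{n+1}$ satisfy $$\|\mathbf e_h^{n+1}\|_h\le\|\widetilde{\mathbf e}_h^{n+1}\|_h .$$
   Context: (HMF): $\partial_t\mathbf m=\Delta\mathbf m+|\nabla\mathbf m|^2\mathbf m$ in $\Omega\times(0,T]$, $\partial_{\mathbf n}\mathbf m=\mathbf 0$ on $\partial\Omega\times(0,T]$, $\mathbf m(\cdot,0)=\mathbf m^0$, where $|\mathbf m^0|=1$; the solution satisfies $|\mathbf m(\mathbf x,t)|=1$. Mesh and space: $d\in\{1,2,3\}$; $\Omega\subset\mathbb R^d$ is a bounded rectangular domain (product of intervals). $\mathscr T_h$ is a mesh of $\Omega$ into Cartesian boxes generated by the tensor product of one-dimensional partitions in each coordinate direction (from a shape-regular, quasi-uniform family). $Q_1(K)$ is the space of polynomials on $K$ of degree at most $1$ in each variable, and $\mathbf S_h^1=\{\mathbf v_h\in H^1(\Omega)^3:\mathbf v_h|_K\in Q_1(K)^3\ \forall K\in\mathscr T_h\}$. $\mathcal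 Q_K$ is the set of vertices of $K$, $\mathcal Q$ the set of all mesh vertices (finite element nodes), $I_h$ the nodal $Q_1$ interpolation operator at $\mathcal Q$ (applied componentwise). Quadrature: the tensor-product two-point Gauss--Lobatto rule, with weights $\omega_{K,\mathbf z}=2^{-d}|K|$, $\mathbf z\in\mathcal Q_K$. For functions with nodal values, $(\mathbf v,\mathbf w)_h=\sum_K\sum_{\mathbf z\in\mathcal Q_K}\omega_{K,\mathbf z}\,\mathbf v(\mathbf z)\cdot\mathbf w(\mathbf z)$ and $\|\mathbf v\|_h^2=(\mathbf v,\mathbf v)_h$; for gradients, $(\nabla\mathbf v,\nabla\mathbf w)_h=\sum_K\sum_{\mathbf z\in\mathcal Q_K}\omega_{K,\mathbf z}\nabla(\mathbf v|_K)(\mathbf z)\cdot\nabla(\mathbf w|_K)(\mathbf z)$ (Frobenius product, gradients taken elementwise). The discrete Laplacian $\widetilde\Delta_h:\mathbf S_h^1\to\mathbf S_h^1$ is defined by $(\widetilde\Delta_h\mathbf v_h,\mathbf w_h)_h=-(\nabla\mathbf v_h,\nabla\mathbf w_h)_h$ for all $\mathbf w_h\in\mathbf S_h^1$. Scheme (S): $T>0$, $N\in\mathbb N$, $\Delta t=T/N$, $t_n=n\Delta t$. Set $\mathbf m_h^0=\widetilde{\mathbf m}_h^0=I_h\mathbf m^0$. For $n=0,\dots,N-1$ find $\widetilde{\mathbf m}_h^{n+1}\in\mathbf S_h^1$ such that for all $\mathbf v_h\in\mathbf S_h^1$ $$\Big(\tfrac{\widetilde{\mathbf m}_h^{n+1}-\mathbf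 m_h^n}{\Delta t},\mathbf v_h\Big)_h=-\big(\mathbf m_h^n\times(\mathbf m_h^n\times\widetilde\Delta_h\widetilde{\mathbf m}_h^{n+1}),\mathbf v_h\big)_h,$$ and set $\mathbf m_h^{n+1}=I_h\big(\widetilde{\mathbf m}_h^{n+1}/|\widetilde{\mathbf m}_h^{n+1}|\big)$. *)

theory Defs
  imports "HOL-Analysis.Analysis"
begin

definition partial_within :: "'d \<Rightarrow> (real^'d) set \<Rightarrow> (real^'d \<Rightarrow> 'b::real_normed_vector) \<Rightarrow> real^'d \<Rightarrow> 'b"
  where "partial_within i S f x = frechet_derivative f (at x within S) (axis i 1)"

abbreviation partial :: "'d \<Rightarrow> (real^'d \<Rightarrow> 'b::real_normed_vector) \<Rightarrow> real^'d \<Rightarrow> 'b"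
  where "partial i \<equiv> partial_within i UNIV"

definition laplacian :: "(real^'d \<Rightarrow> 'b::real_normed_vector) \<Rightarrow> real^'d \<Rightarrow> 'b"
  where "laplacian f x = (\<Sum>i\<in>UNIV. partial i (partial i f) x)"

definition gradient_norm_sq :: "(real^'d \<Rightarrow> 'b::real_normed_vector) \<Rightarrow> real^'d \<Rightarrow> real"
  where "gradient_norm_sq f x = (\<Sum>i\<in>UNIV. (norm (partial i f x))\<^sup>2)"


subsection \<open>The Sobolev space of order one\<close>

primrec k_times_cont_diff :: "nat \<Rightarrow> (real^'d \<Rightarrow> real) \<Rightarrow> bool" where
  "k_times_cont_diff 0 f \<longleftrightarrow> continuous_on UNIV f"
| "k_times_cont_diff (Suc k) f \<longleftrightarrow>
     (\<forall>x. f differentiable (at x)) \<and> (\<forall>i. k_times_cont_diff k (partial i f))"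

definition test_functions :: "(real^'d) set \<Rightarrow> (real^'d \<Rightarrow> real) set"
  where "test_functions \<Omega> = {\<psi>. (\<forall>k. k_times_cont_diff k \<psi>) \<and>
           compact (closure {x. \<psi> x \<noteq> 0}) \<and> closure {x. \<psi> x \<noteq> 0} \<subseteq> \<Omega>}"

definition L2 :: "(real^'d) set \<Rightarrow> (real^'d \<Rightarrow> real) set"
  where "L2 \<Omega> = {f. set_borel_measurable lebesgue \<Omega> f \<and>
                    set_integrable lebesgue \<Omega> (\<lambda>x. (f x)\<^sup>2)}"

definition weak_partial :: "'d \<Rightarrow> (real^'d) set \<Rightarrow> (real^'d \<Rightarrow> real) \<Rightarrow> (real^'d \<Rightarrow> real) \<Rightarrow> bool"
  where "weak_partial i \<Omega> f g \<longleftrightarrow>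
    (\<forall>\<psi>\<in>test_functions \<Omega>.
       (LINT x:\<Omega>|lebesgue. f x * partial i \<psi> x) = - (LINT x:\<Omega>|lebesgue. g x * \<psi> x))"

definition H1 :: "(real^'d) set \<Rightarrow> (real^'d \<Rightarrow> real) set"
  where "H1 \<Omega> = {f \<in> L2 \<Omega>. \<forall>i. \<exists>g\<in>L2 \<Omega>. weak_partial i \<Omega> f g}"


subsection \<open>Tensor-product meshes\<close>

text \<open>The domain is the open box \<open>box a b\<close>; a mesh is represented by the set of its closed cells.
  In direction \<open>i\<close> the partition points are \<open>p i 0 < \<dots> < p i (M i)\<close>.\<close>

definition tensor_product_mesh :: "real^'d \<Rightarrow> real^'d \<Rightarrow> (real^'d) set set \<Rightarrow> bool"
  where "tensor_product_mesh a b \<T> \<longleftrightarrow>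
    (\<exists>(M :: 'd \<Rightarrow> nat) (p :: 'd \<Rightarrow> nat \<Rightarrow> real).
       (\<forall>i. 0 < M i \<and> p i 0 = a $ i \<and> p i (M i) = b $ i \<and> strict_mono_on {..M i} (p i)) \<and>
       \<T> = {cbox (\<chi> i. p i (k i)) (\<chi> i. p i (Suc (k i))) | k. \<forall>i. k i < M i})"

definition inscribed_diameter :: "(real^'d) set \<Rightarrow> real"
  where "inscribed_diameter K = Sup {2 * r | r c. 0 \<le> r \<and> cball c r \<subseteq> K}"

definition shape_regular :: "(real^'d) set set set \<Rightarrow> bool"
  where "shape_regular \<F> \<longleftrightarrow>
    (\<exists>\<sigma>. \<forall>\<T>\<in>\<F>. \<forall>K\<in>\<T>. diameter K \<le> \<sigma> * inscribed_diameter K)"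

definition quasi_uniform :: "(real^'d) set set set \<Rightarrow> bool"
  where "quasi_uniform \<F> \<longleftrightarrow>
    (\<exists>\<tau>>0. \<forall>\<T>\<in>\<F>. \<forall>K\<in>\<T>. \<tau> * (MAX K'\<in>\<T>. diameter K') \<le> diameter K)"

definition cell_vertices :: "(real^'d) set \<Rightarrow> (real^'d) set"
  where "cell_vertices K = {z. z extreme_point_of K}"

definition mesh_nodes :: "(real^'d) set set \<Rightarrow> (real^'d) set"
  where "mesh_nodes \<T> = (\<Union>K\<in>\<T>. cell_vertices K)"


subsection \<open>The finite element space, interpolation and quadrature\<close>

definition Q1_polynomials :: "(real^'d \<Rightarrow> real) set"
  where "Q1_polynomials = {q. \<exists>c :: 'd set \<Rightarrow> real. \<forall>x. q x = (\<Sum>S\<in>UNIV. c S * (\<Prod>i\<in>S. x $ i))}"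

text \<open>Requiring the polynomial representation on the closed cells selects the continuous
  representative of the Sobolev class, which gives nodal values their meaning. The values of a
  total function outside \<open>cbox a b\<close> are irrelevant.\<close>

definition fe_space :: "real^'d \<Rightarrow> real^'d \<Rightarrow> (real^'d) set set \<Rightarrow> (real^'d \<Rightarrow> real^3) set"
  where "fe_space a b \<T> = {v.
    (\<forall>j. (\<lambda>x. v x $ j) \<in> H1 (box a b)) \<and>
    (\<forall>K\<in>\<T>. \<forall>j. \<exists>q\<in>Q1_polynomials. \<forall>x\<in>K. v x $ j = q x)}"

text \<open>Choice is used in \<open>nodal_interp\<close> and \<open>discrete_laplacian\<close> only because the values outside
  \<open>cbox a b\<close> are not determined; on \<open>cbox a b\<close> both are uniquely determined.\<close>

definition nodal_interp ::
    "real^'d \<Rightarrow> real^'d \<Rightarrow> (real^'d) set set \<Rightarrow> (real^'d \<Rightarrow> real^3) \<Rightarrow> real^'d \<Rightarrow> real^3"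
  where "nodal_interp a b \<T> f = (SOME v. v \<in> fe_space a b \<T> \<and> (\<forall>z\<in>mesh_nodes \<T>. v z = f z))"

definition quad_weight :: "(real^'d) set \<Rightarrow> real"
  where "quad_weight K = measure lebesgue K / 2 ^ CARD('d)"

definition inner_h :: "(real^'d) set set \<Rightarrow> (real^'d \<Rightarrow> real^3) \<Rightarrow> (real^'d \<Rightarrow> real^3) \<Rightarrow> real"
  where "inner_h \<T> v w = (\<Sum>K\<in>\<T>. \<Sum>z\<in>cell_vertices K. quad_weight K * (v z \<bullet> w z))"

definition norm_h :: "(real^'d) set set \<Rightarrow> (real^'d \<Rightarrow> real^3) \<Rightarrow> real"
  where "norm_h \<T> v = sqrt (inner_h \<T> v v)"

text \<open>Differentiating \<^emph>\<open>within\<close> the closed cell yields the elementwise gradient at a vertex.\<close>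

definition grad_inner_h :: "(real^'d) set set \<Rightarrow> (real^'d \<Rightarrow> real^3) \<Rightarrow> (real^'d \<Rightarrow> real^3) \<Rightarrow> real"
  where "grad_inner_h \<T> v w = (\<Sum>K\<in>\<T>. \<Sum>z\<in>cell_vertices K.
           quad_weight K * (\<Sum>i\<in>UNIV. partial_within i K v z \<bullet> partial_within i K w z))"

definition discrete_laplacian ::
    "real^'d \<Rightarrow> real^'d \<Rightarrow> (real^'d) set set \<Rightarrow> (real^'d \<Rightarrow> real^3) \<Rightarrow> real^'d \<Rightarrow> real^3"
  where "discrete_laplacian a b \<T> v = (SOME L. L \<in> fe_space a b \<T> \<and>
           (\<forall>w\<in>fe_space a b \<T>. inner_h \<T> L w = - grad_inner_h \<T> v w))"


subsection \<open>The scheme and the continuous problem\<close>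

text \<open>\<open>mt n\<close> is the auxiliary iterate (with tilde), \<open>mh n\<close> the projected one.\<close>

definition scheme_solution ::
    "real^'d \<Rightarrow> real^'d \<Rightarrow> (real^'d) set set \<Rightarrow> real \<Rightarrow> nat \<Rightarrow> (real^'d \<Rightarrow> real^3)
      \<Rightarrow> (nat \<Rightarrow> real^'d \<Rightarrow> real^3) \<Rightarrow> (nat \<Rightarrow> real^'d \<Rightarrow> real^3) \<Rightarrow> bool"
  where "scheme_solution a b \<T> T N m0 mt mh \<longleftrightarrow>
    mh 0 = nodal_interp a b \<T> m0 \<and> mt 0 = nodal_interp a b \<T> m0 \<and>
    (\<forall>n<N.
       mt (Suc n) \<in> fe_space a b \<T> \<and>
       (\<forall>v\<in>fe_space a b \<T>.
          inner_h \<T> (\<lambda>x. (mt (Suc n) x - mh n x) /\<^sub>R (T / real N)) v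
          = - inner_h \<T> (\<lambda>x. cross3 (mh n x)
                (cross3 (mh n x) (discrete_laplacian a b \<T> (mt (Suc n)) x))) v) \<and>
       mh (Suc n) = nodal_interp a b \<T> (\<lambda>x. mt (Suc n) x /\<^sub>R norm (mt (Suc n) x)))"

text \<open>The normal is defined on the relatively open faces only, not on lower-dimensional edges.\<close>

definition outward_normal :: "real^'d \<Rightarrow> real^'d \<Rightarrow> real^'d \<Rightarrow> real^'d \<Rightarrow> bool"
  where "outward_normal a b x \<nu> \<longleftrightarrow>
    (\<exists>i. (\<forall>j. j \<noteq> i \<longrightarrow> a $ j < x $ j \<and> x $ j < b $ j) \<and>
         (x $ i = a $ i \<and> \<nu> = - axis i 1 \<or> x $ i = b $ i \<and> \<nu> = axis i 1))"

definition hmf_solution ::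
    "real^'d \<Rightarrow> real^'d \<Rightarrow> real \<Rightarrow> (real^'d \<Rightarrow> real^3) \<Rightarrow> (real \<Rightarrow> real^'d \<Rightarrow> real^3) \<Rightarrow> bool"
  where "hmf_solution a b T m0 m \<longleftrightarrow>
    (\<forall>t\<in>{0<..T}. \<forall>x\<in>box a b.
       m t differentiable (at x) \<and>
       (\<forall>i. partial i (m t) differentiable (at x)) \<and>
       ((\<lambda>s. m s x) has_vector_derivative
          (laplacian (m t) x + gradient_norm_sq (m t) x *\<^sub>R m t x)) (at t within {0..T})) \<and>
    (\<forall>t\<in>{0<..T}. \<forall>x \<nu>. outward_normal a b x \<nu> \<longrightarrow>
       ((\<lambda>s. m t (x + s *\<^sub>R \<nu>)) has_vector_derivative 0) (at 0 within {..0})) \<and>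
    (\<forall>x\<in>cbox a b. m 0 x = m0 x) \<and>
    (\<forall>x\<in>box a b. ((\<lambda>t. m t x) \<longlongrightarrow> m0 x) (at_right 0))"

end

theory Submission
  imports Defs
begin

text \<open>Testing the scheme with nodal interpolants shows that at every node the increment
  \<open>mt (n + 1) - mh n\<close> is a cross product with \<open>mh n\<close>, hence orthogonal to it. By Pythagoras
  and induction on \<open>n\<close> the nodal values satisfy \<open>norm (mh n) = 1 \<le> norm (mt (n + 1))\<close>, and the radial
  projection of a vector of length at least one does not increase its distance to a unit
  vector. The Gauss-Lobatto norm sees only nodal values and has positive weights.

  What needs work is that nodal interpolants exist in the finite element space: they are
  combinations of tensor products of one-dimensional hat functions, and a Lipschitz function with
  partial derivatives almost everywhere has these as weak partial derivatives.\<close>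

subsection \<open>Lipschitz functions and weak derivatives\<close>

text \<open>The chain rule along a coordinate line; it opens the partial derivatives of test
  functions to the one-dimensional mean value theorem and to limits of difference quotients.\<close>

lemma has_real_derivative_partial:
  fixes f :: "real^'d \<Rightarrow> real"
  assumes "f differentiable (at (x + s *\<^sub>R axis i 1))"
  shows "((\<lambda>s. f (x + s *\<^sub>R axis i 1)) has_real_derivative partial i f (x + s *\<^sub>R axis i 1)) (at s)"
proof -
  let ?e = "axis i 1 :: real^'d"
  let ?F = "frechet_derivative f (at (x + s *\<^sub>R ?e))"
  have F: "(f has_derivative ?F) (at (x + s *\<^sub>R ?e))"
    using assms by (simp add: frechet_derivative_works)
  have "((\<lambda>s. x + s *\<^sub>R ?e) has_derivative (\<lambda>h. h *\<^sub>R ?e)) (at s)"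
    by (auto intro!: derivative_eq_intros)
  from has_derivative_compose[OF this F]
  have "((\<lambda>s. f (x + s *\<^sub>R ?e)) has_derivative (\<lambda>h. ?F (h *\<^sub>R ?e))) (at s)" .
  moreover have "?F (h *\<^sub>R ?e) = partial i f (x + s *\<^sub>R ?e) * h" for h
    using has_derivative_bounded_linear[OF F]
    by (simp add: partial_within_def linear_simps)
  ultimately show ?thesis
    by (simp add: has_field_derivative_def)
qed

text \<open>The complement of the closed support is open, so \<open>f\<close> agrees with the zero
  function in a neighbourhood of \<open>x\<close>, and differentiation is local.\<close>

lemma partial_eq_0_outside_support:
  fixes f :: "real^'d \<Rightarrow> real"
  assumes "x \<notin> closure {x. f x \<noteq> 0}"
  shows "partial i f x = 0"
proof -
  have "((\<lambda>_. 0) has_derivative (\<lambda>_. 0)) (at x)" by simp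
  then have "(f has_derivative (\<lambda>_. 0)) (at x)"
    by (rule has_derivative_transform_within_open[of _ _ _ _ "- closure {x. f x \<noteq> 0}"])
      (use assms closure_subset[of "{x. f x \<noteq> 0}"] in auto)
  then have "frechet_derivative f (at x) = (\<lambda>_. 0)"
    by (simp add: frechet_derivative_at[symmetric])
  then show ?thesis by (simp add: partial_within_def)
qed

lemma integrable_continuous_compact_support:
  fixes f :: "'a::euclidean_space \<Rightarrow> real"
  assumes "continuous_on UNIV f" "compact S" "\<And>x. x \<notin> S \<Longrightarrow> f x = 0"
  shows "integrable lborel f"
proof -
  have "integrable lborel (\<lambda>x. indicator S x *\<^sub>R f x)"
    using assms by (intro borel_integrable_compact) (auto intro: continuous_on_subset)
  also have "(\<lambda>x. indicator S x *\<^sub>R f x) = f"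
    using assms(3) by (auto simp: fun_eq_iff indicator_def)
  finally show ?thesis .
qed

text \<open>Links two settings: \<open>weak_partial\<close> integrates over \<open>\<Omega>\<close>
  with the completed measure, while translation invariance and dominated convergence are used on the
  whole space with \<open>lborel\<close>. The indicator is absorbed because \<open>f\<close>
  vanishes off \<open>\<Omega>\<close>, and completion does not change integrals of Borel
  functions.\<close>

lemma set_lebesgue_integral_eq_lborel:
  fixes f :: "real^'d \<Rightarrow> real"
  assumes "f \<in> borel_measurable borel" "\<And>x. x \<notin> \<Omega> \<Longrightarrow> f x = 0"
  shows "(LINT x:\<Omega>|lebesgue. f x) = integral\<^sup>L lborel f"
proof -
  have "(LINT x:\<Omega>|lebesgue. f x) = integral\<^sup>L lebesgue f"
    unfolding set_lebesgue_integral_def using assms(2)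
    by (intro Bochner_Integration.integral_cong) (auto simp: indicator_def)
  then show ?thesis
    using assms(1) by (simp add: integral_completion)
qed

lemma lborel_integral_translation:
  fixes f :: "'a::euclidean_space \<Rightarrow> real"
  assumes "f \<in> borel_measurable borel"
  shows "(LINT x|lborel. f (c + x)) = integral\<^sup>L lborel f"
  using integral_distr[of "(+) c" lborel borel f] assms by (simp add: lborel_distr_plus)

lemma filterlim_inverse_Suc: "filterlim (\<lambda>n. inverse (real (Suc n))) (at 0) sequentially"
  using LIMSEQ_inverse_real_of_nat by (auto simp: filterlim_at)

text \<open>Both one-sided forms occur below: a translation turns the forward quotient of the test
  function into the backward quotient of the Lipschitz function.\<close>

lemma difference_quotient_Suc_tendsto:
  assumes "(f has_real_derivative D) (at 0)"
  shows "(\<lambda>n. (f (inverse (real (Suc n))) - f 0) / inverse (real (Suc n))) \<longlonglongrightarrow> D"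
    and "(\<lambda>n. (f 0 - f (- inverse (real (Suc n)))) / inverse (real (Suc n))) \<longlonglongrightarrow> D"
proof -
  have *: "((\<lambda>h. (f h - f 0) / h) \<longlongrightarrow> D) (at 0)"
    using assms by (simp add: DERIV_def)
  show "(\<lambda>n. (f (inverse (real (Suc n))) - f 0) / inverse (real (Suc n))) \<longlonglongrightarrow> D"
    by (rule filterlim_compose[OF * filterlim_inverse_Suc])
  have "filterlim (\<lambda>n. - inverse (real (Suc n))) (at 0) sequentially"
    using tendsto_minus[OF LIMSEQ_inverse_real_of_nat] by (auto simp: filterlim_at)
  from filterlim_compose[OF * this]
  have "(\<lambda>n. (f (- inverse (real (Suc n))) - f 0) / - inverse (real (Suc n))) \<longlonglongrightarrow> D" .
  then show "(\<lambda>n. (f 0 - f (- inverse (real (Suc n)))) / inverse (real (Suc n))) \<longlonglongrightarrow> D"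
    by (simp add: minus_divide_left)
qed

text \<open>Translation invariance moves the difference quotient from the test function to \<open>u\<close>; the
  Lipschitz bound then allows dominated convergence on both sides. Clamping \<open>g\<close> to \<open>[-L, L]\<close>
  controls it also where \<open>lim\<close> is unspecified.\<close>

lemma lipschitz_weak_partial:
  fixes u :: "real^'d \<Rightarrow> real"
  assumes u: "L-lipschitz_on UNIV u"
    and D: "AE x in lborel. \<exists>D. ((\<lambda>s. u (x + s *\<^sub>R axis i 1)) has_real_derivative D) (at 0)"
  obtains g where "g \<in> borel_measurable borel" "\<And>x. \<bar>g x\<bar> \<le> L" "\<And>\<Omega>. weak_partial i \<Omega> u g"
proof -
  define e where "e = (axis i 1 :: real^'d)"
  \<comment> \<open>Dominated convergence works along sequences, hence a sequence of step
    lengths.\<close>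
  define h where "h n = inverse (real (Suc n))" for n
  have h: "0 < h n" "h n \<le> 1" for n
    by (auto simp: h_def field_simps)
  have e: "norm e = 1" by (simp add: e_def)
  define Du where "Du n x = (u x - u (x - h n *\<^sub>R e)) / h n" for n x
  define g where "g x = max (- L) (min L (lim (\<lambda>n. Du n x)))" for x
  have L: "0 \<le> L" using u by (rule lipschitz_on_nonneg)
  have cu: "continuous_on UNIV u" using u by (rule lipschitz_on_continuous_on)
  have cu': "continuous_on UNIV (\<lambda>x. u (x + c))" for c
    by (rule continuous_on_compose2[OF cu]) (auto intro!: continuous_intros)
  have mDu [measurable]: "Du n \<in> borel_measurable borel" for n
    unfolding Du_def
    using borel_measurable_continuous_onI[OF cu] borel_measurable_continuous_onI[OF cu'[of "- (h n *\<^sub>R e)"]]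
    by simp
  have mg [measurable]: "g \<in> borel_measurable borel"
    unfolding g_def by measurable
  have bg: "\<bar>g x\<bar> \<le> L" for x using L by (auto simp: g_def)
  have bDu: "\<bar>Du n x\<bar> \<le> L" for n x
  proof -
    have "\<bar>u x - u (x - h n *\<^sub>R e)\<bar> \<le> L * norm (x - (x - h n *\<^sub>R e))"
      using lipschitz_on_normD[OF u, of x "x - h n *\<^sub>R e"] by simp
    then show ?thesis using h[of n] by (simp add: Du_def e field_simps)
  qed
  have Du_lim: "AE x in lborel. (\<lambda>n. Du n x) \<longlonglongrightarrow> g x"
    using D
  proof eventually_elim
    case (elim x)
    then obtain D where "((\<lambda>s. u (x + s *\<^sub>R e)) has_real_derivative D) (at 0)" by (auto simp: e_def)
    from difference_quotient_Suc_tendsto(2)[OF this] have *: "(\<lambda>n. Du n x) \<longlonglongrightarrow> D"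
      by (simp add: Du_def h_def)
    \<comment> \<open>The limit inherits the bound on the quotients, so the clamp in
      \<open>g\<close> leaves it unchanged at such points.\<close>
    moreover have "\<bar>D\<bar> \<le> L"
      by (rule LIMSEQ_le_const2[OF tendsto_rabs[OF *]]) (use bDu in auto)
    ultimately show ?case using limI[OF *] by (simp add: g_def)
  qed
  have "weak_partial i \<Omega> u g" for \<Omega>
    unfolding weak_partial_def
  proof
    fix \<psi> assume \<psi>: "\<psi> \<in> test_functions \<Omega>"
    define S where "S = closure {x. \<psi> x \<noteq> 0}"
    have S: "compact S" "S \<subseteq> \<Omega>" using \<psi> by (auto simp: test_functions_def S_def)
    have S0: "x \<notin> S \<Longrightarrow> \<psi> x = 0" for x
      using closure_subset[of "{x. \<psi> x \<noteq> 0}"] by (auto simp: S_def)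
    have dS0: "x \<notin> S \<Longrightarrow> partial i \<psi> x = 0" for x
      by (auto simp: S_def intro: partial_eq_0_outside_support)
    have k: "k_times_cont_diff k \<psi>" for k using \<psi> by (auto simp: test_functions_def)
    have c\<psi>: "continuous_on UNIV \<psi>" using k[of 0] by simp
    have d\<psi>: "\<psi> differentiable (at x)" for x using k[of "Suc 0"] by simp
    have cp: "continuous_on UNIV (partial i \<psi>)" using k[of "Suc 0"] by simp
    have c\<psi>': "continuous_on UNIV (\<lambda>x. \<psi> (x + c))" for c
      by (rule continuous_on_compose2[OF c\<psi>]) (auto intro!: continuous_intros)
    have [measurable]: "u \<in> borel_measurable borel" "\<psi> \<in> borel_measurable borel"
        "partial i \<psi> \<in> borel_measurable borel" "(\<lambda>x. \<psi> (x + c)) \<in> borel_measurable borel"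
        "(\<lambda>x. u (x + c)) \<in> borel_measurable borel" for c
      by (intro borel_measurable_continuous_onI cu c\<psi> cp c\<psi>' cu')+
    define Dp where "Dp n x = (\<psi> (x + h n *\<^sub>R e) - \<psi> x) / h n" for n x
    have line: "((\<lambda>s. \<psi> (x + s *\<^sub>R e)) has_real_derivative partial i \<psi> (x + s *\<^sub>R e)) (at s)" for x s
      unfolding e_def by (rule has_real_derivative_partial[OF d\<psi>])
    have Dp_lim: "(\<lambda>n. Dp n x) \<longlonglongrightarrow> partial i \<psi> x" for x
      using difference_quotient_Suc_tendsto(1)[OF line[of x 0, simplified]] line[of x 0]
      by (simp add: Dp_def h_def)
    obtain R where R: "\<And>x. x \<in> S \<Longrightarrow> norm x \<le> R"
      using compact_imp_bounded[OF S(1)] by (auto simp: bounded_iff)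
    \<comment> \<open>Steps have length at most 1, so every quotient \<open>Dp n\<close> vanishes
      outside the ball of radius \<open>R + 1\<close>, and the intermediate points of the mean value
      theorem stay within radius \<open>R + 2\<close>. One compact set thus serves all
      \<open>n\<close>.\<close>
    define S' where "S' = cball (0::real^'d) (R + 1)"
    have S': "compact S'" by (simp add: S'_def)
    have "compact (partial i \<psi> ` cball 0 (R + 2))"
      by (intro compact_continuous_image) (auto intro: continuous_on_subset[OF cp])
    then obtain B where "\<forall>x\<in>cball 0 (R + 2). \<bar>partial i \<psi> x\<bar> \<le> B"
      by (auto dest!: compact_imp_bounded simp: bounded_iff)
    then have B: "norm x \<le> R + 2 \<Longrightarrow> \<bar>partial i \<psi> x\<bar> \<le> B" for x by simp
    have "compact (u ` S')"
      by (intro compact_continuous_image) (auto intro: continuous_on_subset[OF cu] S')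
    then obtain C where C: "\<forall>x\<in>S'. \<bar>u x\<bar> \<le> C"
      by (auto dest!: compact_imp_bounded simp: bounded_iff)
    have Dp0: "Dp n x = 0" if "x \<notin> S'" for n x
    proof -
      have x: "R + 1 < norm x" using that by (simp add: S'_def)
      have "norm x \<le> norm (x + h n *\<^sub>R e) + norm (h n *\<^sub>R e)"
        using norm_triangle_ineq4[of "x + h n *\<^sub>R e" "h n *\<^sub>R e"] by simp
      then have "R < norm (x + h n *\<^sub>R e)" using x h[of n] by (simp add: e)
      then have "x \<notin> S" "x + h n *\<^sub>R e \<notin> S" using R x by force+
      then show ?thesis by (simp add: Dp_def S0)
    qed
    have DpB: "\<bar>Dp n x\<bar> \<le> B" if "x \<in> S'" for n x
    proof -
      \<comment> \<open>The mean value theorem bounds the quotients of the test function uniformly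
        in \<open>n\<close>, as a dominating function requires.\<close>
      obtain s where s: "0 < s" "s < h n"
        and eq: "\<psi> (x + h n *\<^sub>R e) - \<psi> (x + 0 *\<^sub>R e) = (h n - 0) * partial i \<psi> (x + s *\<^sub>R e)"
        using MVT2[of 0 "h n" "\<lambda>s. \<psi> (x + s *\<^sub>R e)" "\<lambda>s. partial i \<psi> (x + s *\<^sub>R e)"] line h[of n] by blast
      have "Dp n x = partial i \<psi> (x + s *\<^sub>R e)" using eq h[of n] by (simp add: Dp_def)
      moreover have "norm (x + s *\<^sub>R e) \<le> R + 2"
        using norm_triangle_ineq[of x "s *\<^sub>R e"] that s h[of n] by (simp add: e S'_def)
      ultimately show ?thesis using B by simp
    qed
    have uDpB: "\<bar>u x * Dp n x\<bar> \<le> C * B" if "x \<in> S'" for n x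
      unfolding abs_mult using C[rule_format, OF that] DpB[OF that, of n]
      by (intro mult_mono) linarith+
    have int1: "integrable lborel (\<lambda>x. u x * \<psi> x)"
      by (rule integrable_continuous_compact_support[OF _ S(1)])
        (auto intro!: continuous_intros cu c\<psi> simp: S0)
    have int2: "integrable lborel (\<lambda>x. u (x + c) * \<psi> x)" for c
      by (rule integrable_continuous_compact_support[OF _ S(1)])
        (auto intro!: continuous_intros cu' c\<psi> simp: S0)
    have int3: "integrable lborel (\<lambda>x. u x * \<psi> (x + c))" for c
    proof (rule integrable_continuous_compact_support)
      show "compact ((+) (- c) ` S)" by (intro compact_translation S)
      show "continuous_on UNIV (\<lambda>x. u x * \<psi> (x + c))" by (intro continuous_intros cu c\<psi>')
      show "u x * \<psi> (x + c) = 0" if "x \<notin> (+) (- c) ` S" for x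
      proof -
        have "x + c \<notin> S"
        proof
          assume "x + c \<in> S"
          then have "- c + (x + c) \<in> (+) (- c) ` S" by (rule imageI)
          then show False using that by simp
        qed
        then show ?thesis by (simp add: S0)
      qed
    qed
    have parts: "(LINT x|lborel. u x * Dp n x) = - (LINT x|lborel. Du n x * \<psi> x)" for n
    proof -
      let ?c = "h n *\<^sub>R e"
      have shift: "(LINT x|lborel. u x * \<psi> (x + ?c)) = (LINT x|lborel. u (x - ?c) * \<psi> x)"
        using lborel_integral_translation[of "\<lambda>x. u (x - ?c) * \<psi> x" ?c] 
           \<open>(\<lambda>x. u (x + - ?c)) \<in> borel_measurable borel\<close>
        by (simp add: add.commute)
      have "(LINT x|lborel. u x * Dp n x)
          = (LINT x|lborel. (u x * \<psi> (x + ?c) - u x * \<psi> x) / h n)"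
        by (simp add: Dp_def algebra_simps)
      also have "\<dots> = ((LINT x|lborel. u x * \<psi> (x + ?c)) - (LINT x|lborel. u x * \<psi> x)) / h n"
        using int1 int3[of ?c] by simp
      also have "\<dots> = ((LINT x|lborel. u (x - ?c) * \<psi> x) - (LINT x|lborel. u x * \<psi> x)) / h n"
        by (simp only: shift)
      also have "\<dots> = (LINT x|lborel. (u (x - ?c) * \<psi> x - u x * \<psi> x) / h n)"
        using int1 int2[of "- ?c"] by simp
      also have "\<dots> = (LINT x|lborel. - (Du n x * \<psi> x))"
        using h(1)[of n] by (intro Bochner_Integration.integral_cong) (auto simp: Du_def field_simps)
      finally show ?thesis by simp
    qed
    have lim1: "(\<lambda>n. LINT x|lborel. u x * Dp n x) \<longlonglongrightarrow> (LINT x|lborel. u x * partial i \<psi> x)"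
    proof (rule integral_dominated_convergence[where w = "\<lambda>x. indicator S' x *\<^sub>R (C * B)"])
      show "integrable lborel (\<lambda>x. indicator S' x *\<^sub>R (C * B))"
        by (intro borel_integrable_compact S') simp
      show "AE x in lborel. (\<lambda>n. u x * Dp n x) \<longlonglongrightarrow> u x * partial i \<psi> x"
        by (intro AE_I2 tendsto_intros Dp_lim)
      show "AE x in lborel. norm (u x * Dp n x) \<le> indicator S' x *\<^sub>R (C * B)" for n
        using uDpB[of _ n] Dp0[of _ n] by (intro AE_I2) (auto simp: indicator_def)
    qed (simp_all add: Dp_def)
    have lim2: "(\<lambda>n. LINT x|lborel. Du n x * \<psi> x) \<longlonglongrightarrow> (LINT x|lborel. g x * \<psi> x)"
    proof (rule integral_dominated_convergence[where w = "\<lambda>x. L * \<bar>\<psi> x\<bar>"])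
      show "integrable lborel (\<lambda>x. L * \<bar>\<psi> x\<bar>)"
        by (rule integrable_continuous_compact_support[OF _ S(1)])
          (auto intro!: continuous_intros c\<psi> simp: S0)
      show "AE x in lborel. (\<lambda>n. Du n x * \<psi> x) \<longlonglongrightarrow> g x * \<psi> x"
        using Du_lim by eventually_elim (intro tendsto_intros)
      show "AE x in lborel. norm (Du n x * \<psi> x) \<le> L * \<bar>\<psi> x\<bar>" for n
        using bDu by (intro AE_I2) (auto simp: abs_mult intro!: mult_right_mono)
    qed simp_all
    have "(LINT x|lborel. u x * partial i \<psi> x) = - (LINT x|lborel. g x * \<psi> x)"
      using LIMSEQ_unique[OF lim1] tendsto_minus[OF lim2] by (simp add: parts)
    moreover have "(LINT x:\<Omega>|lebesgue. u x * partial i \<psi> x) = (LINT x|lborel. u x * partial i \<psi> x)"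
      by (rule set_lebesgue_integral_eq_lborel) (use S(2) dS0 in auto)
    moreover have "(LINT x:\<Omega>|lebesgue. g x * \<psi> x) = (LINT x|lborel. g x * \<psi> x)"
      by (rule set_lebesgue_integral_eq_lborel) (use S(2) S0 in auto)
    ultimately show "(LINT x:\<Omega>|lebesgue. u x * partial i \<psi> x) = - (LINT x:\<Omega>|lebesgue. g x * \<psi> x)"
      by simp
  qed
  then show thesis using mg bg that by blast
qed

text \<open>A box has finite measure, so a constant dominates the square. The bound is asked for on
  the box alone, since a Lipschitz function may be unbounded on the whole space.\<close>

lemma bounded_measurable_L2_box:
  fixes f :: "real^'d \<Rightarrow> real"
  assumes [measurable]: "f \<in> borel_measurable borel" and "\<And>x. x \<in> box a b \<Longrightarrow> \<bar>f x\<bar> \<le> C"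
  shows "f \<in> L2 (box a b)"
proof -
  have "set_borel_measurable lborel (box a b) f"
    unfolding set_borel_measurable_def by measurable
  then have "set_borel_measurable lebesgue (box a b) f"
    unfolding set_borel_measurable_def by (rule measurable_completion)
  moreover have "integrable lborel (\<lambda>x. indicator (box a b) x *\<^sub>R (f x)\<^sup>2)"
  proof (rule Bochner_Integration.integrable_bound)
    show "integrable lborel (\<lambda>x. indicator (box a b) x *\<^sub>R C\<^sup>2)"
      by (intro integrable_real_indicator integrable_scaleR_left) (use emeasure_lborel_box_finite[of a b] in auto)
    show "AE x in lborel. norm (indicator (box a b) x *\<^sub>R (f x)\<^sup>2) \<le> norm (indicator (box a b) x *\<^sub>R C\<^sup>2)"
      using assms(2) by (intro AE_I2) (auto simp: indicator_def intro!: abs_le_square_iff[THEN iffD1] order_trans[OF _ abs_ge_self])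
  qed measurable
  then have "set_integrable lebesgue (box a b) (\<lambda>x. (f x)\<^sup>2)"
    unfolding set_integrable_def by (subst integrable_completion) auto
  ultimately show ?thesis by (simp add: L2_def)
qed

lemma lipschitz_in_H1_box:
  fixes u :: "real^'d \<Rightarrow> real"
  assumes u: "L-lipschitz_on UNIV u"
    and D: "\<And>i. AE x in lborel. \<exists>D. ((\<lambda>s. u (x + s *\<^sub>R axis i 1)) has_real_derivative D) (at 0)"
  shows "u \<in> H1 (box a b)"
proof -
  have cu: "continuous_on UNIV u" using u by (rule lipschitz_on_continuous_on)
  have "compact (u ` cbox a b)"
    by (intro compact_continuous_image continuous_on_subset[OF cu]) auto
  then obtain C where "\<forall>x\<in>cbox a b. \<bar>u x\<bar> \<le> C"
    by (auto dest!: compact_imp_bounded simp: bounded_iff)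
  then have "u \<in> L2 (box a b)"
    using box_subset_cbox[of a b]
    by (intro bounded_measurable_L2_box[where C = C] borel_measurable_continuous_onI cu) blast
  moreover have "\<exists>g\<in>L2 (box a b). weak_partial i (box a b) u g" for i
    by (rule lipschitz_weak_partial[OF u D[of i]]) (blast intro: bounded_measurable_L2_box)
  ultimately show ?thesis by (simp add: H1_def)
qed


subsection \<open>Tensor products of hat functions\<close>

text \<open>As a clamped minimum of two affine functions the hat inherits Lipschitz continuity from
  them directly; the piecewise form is recovered in \<open>hat_pieces\<close>.\<close>

definition hat :: "real \<Rightarrow> real \<Rightarrow> real \<Rightarrow> real \<Rightarrow> real"
  where "hat l c r x = max 0 (min ((x - l) / (c - l)) ((r - x) / (r - c)))"

context
  fixes l c r :: real
  assumes lcr: "l < c" "c < r"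
begin

text \<open>Between \<open>l\<close> and \<open>r\<close> one of the two affine functions lies in
  [0, 1] while the other is at least 1, which decides the minimum. Outside, one of them is
  nonpositive, which decides the maximum.\<close>

lemma hat_pieces:
  "x \<le> l \<Longrightarrow> hat l c r x = 0"
  "l \<le> x \<Longrightarrow> x \<le> c \<Longrightarrow> hat l c r x = (x - l) / (c - l)"
  "c \<le> x \<Longrightarrow> x \<le> r \<Longrightarrow> hat l c r x = (r - x) / (r - c)"
  "r \<le> x \<Longrightarrow> hat l c r x = 0"
proof -
  show "hat l c r x = 0" if "x \<le> l"
    using divide_nonpos_pos[of "x - l" "c - l"] that lcr by (simp add: hat_def)
  show "hat l c r x = 0" if "r \<le> x"
    using divide_nonpos_pos[of "r - x" "r - c"] that lcr by (simp add: hat_def)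
  show "hat l c r x = (x - l) / (c - l)" if "l \<le> x" "x \<le> c"
  proof -
    have "0 \<le> (x - l) / (c - l)" "(x - l) / (c - l) \<le> 1" "1 \<le> (r - x) / (r - c)"
      using that lcr by auto
    then show ?thesis by (simp add: hat_def)
  qed
  show "hat l c r x = (r - x) / (r - c)" if "c \<le> x" "x \<le> r"
  proof -
    have "0 \<le> (r - x) / (r - c)" "(r - x) / (r - c) \<le> 1" "1 \<le> (x - l) / (c - l)"
      using that lcr by auto
    then show ?thesis by (simp add: hat_def)
  qed
qed

lemma hat_affine_pieces:
  "l \<le> x \<Longrightarrow> x \<le> c \<Longrightarrow> hat l c r x = - l / (c - l) + 1 / (c - l) * x"
  "c \<le> x \<Longrightarrow> x \<le> r \<Longrightarrow> hat l c r x = r / (r - c) + - 1 / (r - c) * x"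
  by (simp_all add: hat_pieces(2,3) diff_divide_distrib)

lemma abs_hat_le_1: "\<bar>hat l c r x\<bar> \<le> 1"
proof -
  have "x \<le> c \<Longrightarrow> (x - l) / (c - l) \<le> 1" "c \<le> x \<Longrightarrow> (r - x) / (r - c) \<le> 1"
    using lcr by auto
  then show ?thesis unfolding hat_def by linarith
qed

text \<open>Under \<open>min\<close> and \<open>max\<close> the change is at most the larger of the
  changes of the two affine functions. Taking the sum of both slopes avoids any case distinction on
  the position of the points.\<close>

lemma lipschitz_hat: "(1 / (c - l) + 1 / (r - c))-lipschitz_on UNIV (hat l c r)"
proof (rule lipschitz_onI)
  show "0 \<le> 1 / (c - l) + 1 / (r - c)" using lcr by simp
  fix x y :: real
  have "\<bar>(x - l) / (c - l) - (y - l) / (c - l)\<bar> = 1 / (c - l) * \<bar>x - y\<bar>"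
    using lcr by (simp add: abs_divide flip: diff_divide_distrib)
  moreover have "\<bar>(r - x) / (r - c) - (r - y) / (r - c)\<bar> = 1 / (r - c) * \<bar>x - y\<bar>"
    using lcr by (simp flip: diff_divide_distrib)
  ultimately have "\<bar>hat l c r x - hat l c r y\<bar> \<le> 1 / (c - l) * \<bar>x - y\<bar> + 1 / (r - c) * \<bar>x - y\<bar>"
    unfolding hat_def by linarith
  then show "dist (hat l c r x) (hat l c r y) \<le> (1 / (c - l) + 1 / (r - c)) * dist x y"
    by (simp add: dist_real_def ring_distribs)
qed

lemma hat_differentiable:
  assumes "x \<notin> {l, c, r}"
  shows "\<exists>D. (hat l c r has_real_derivative D) (at x)"
proof -
  have ex: ?thesis
    if S: "open S" "x \<in> S" and eq: "\<And>y. y \<in> S \<Longrightarrow> \<alpha> + \<beta> * y = hat l c r y" for S \<alpha> \<beta>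
  proof
    have "((\<lambda>y. \<alpha> + \<beta> * y) has_real_derivative \<beta>) (at x)"
      by (auto intro!: derivative_eq_intros)
    then show "(hat l c r has_real_derivative \<beta>) (at x)"
      using S eq by (rule has_field_derivative_transform_within_open)
  qed
  from assms consider "x < l" | "l < x" "x < c" | "c < x" "x < r" | "r < x"
    by fastforce
  then show ?thesis
  proof cases
    case 1
    show ?thesis by (rule ex[of "{..<l}" 0 0]) (use 1 hat_pieces in auto)
  next
    case 2
    show ?thesis
      by (rule ex[of "{l<..<c}" "- l / (c - l)" "1 / (c - l)"])
        (use 2 in \<open>simp_all add: hat_affine_pieces(1)\<close>)
  next
    case 3
    show ?thesis
      by (rule ex[of "{c<..<r}" "r / (r - c)" "- 1 / (r - c)"])
        (use 3 in \<open>simp_all add: hat_affine_pieces(2)\<close>)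
  next
    case 4
    show ?thesis by (rule ex[of "{r<..}" 0 0]) (use 4 hat_pieces in auto)
  qed
qed

lemma hat_affine_on:
  assumes "{s..t} \<subseteq> {..l} \<or> {s..t} \<subseteq> {l..c} \<or> {s..t} \<subseteq> {c..r} \<or> {s..t} \<subseteq> {r..}"
  shows "\<exists>\<alpha> \<beta>. \<forall>x\<in>{s..t}. hat l c r x = \<alpha> + \<beta> * x"
proof -
  consider "{s..t} \<subseteq> {..l}" | "{s..t} \<subseteq> {l..c}" | "{s..t} \<subseteq> {c..r}" | "{s..t} \<subseteq> {r..}"
    using assms by blast
  then show ?thesis
  proof cases
    case 1
    then show ?thesis by (intro exI[of _ 0]) (use hat_pieces(1) in force)
  next
    case 2
    then have "\<forall>x\<in>{s..t}. hat l c r x = - l / (c - l) + 1 / (c - l) * x"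
      by (intro ballI hat_affine_pieces) auto
    then show ?thesis by (intro exI)
  next
    case 3
    then have "\<forall>x\<in>{s..t}. hat l c r x = r / (r - c) + - 1 / (r - c) * x"
      by (intro ballI hat_affine_pieces) auto
    then show ?thesis by (intro exI)
  next
    case 4
    then show ?thesis by (intro exI[of _ 0]) (use hat_pieces(4) in force)
  qed
qed

end

text \<open>A coordinate hyperplane is a null set. For a tensor hat and direction \<open>i\<close>,
  three such hyperplanes contain all points where the restriction to a line in that direction may
  have a kink.\<close>

lemma AE_lborel_nth_noteq: "AE x in lborel. (x :: real^'d) $ i \<noteq> c"
proof -
  have "negligible {x :: real^'d. x \<bullet> axis i 1 = c}"
    by (rule negligible_standard_hyperplane) (simp add: axis_in_Basis_iff)
  then have "{x :: real^'d. x $ i = c} \<in> null_sets lebesgue"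
    by (simp add: inner_axis negligible_iff_null_sets)
  from AE_not_in[OF this] show ?thesis
    by (simp add: AE_completion_iff)
qed

text \<open>With neighbouring mesh coordinates as \<open>l\<close> and \<open>r\<close>, this is the
  nodal Q1 basis function of the node \<open>c\<close>.\<close>

definition tensor_hat :: "real^'d \<Rightarrow> real^'d \<Rightarrow> real^'d \<Rightarrow> real^'d \<Rightarrow> real"
  where "tensor_hat l c r x = (\<Prod>i\<in>UNIV. hat (l $ i) (c $ i) (r $ i) (x $ i))"

context
  fixes l c r :: "real^'d"
  assumes lcr: "\<And>i. l $ i < c $ i" "\<And>i. c $ i < r $ i"
begin

lemma lipschitz_tensor_hat: "\<exists>L. L-lipschitz_on UNIV (tensor_hat l c r)"
proof
  let ?L = "\<lambda>i. 1 / (c $ i - l $ i) + 1 / (r $ i - c $ i)"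
  show "(\<Sum>i\<in>UNIV. ?L i)-lipschitz_on UNIV (tensor_hat l c r)"
  proof (rule lipschitz_onI)
    have L: "0 \<le> ?L i" for i using lcr[of i] by simp
    then show "0 \<le> (\<Sum>i\<in>UNIV. ?L i)" by (intro sum_nonneg) simp
    fix x y :: "real^'d"
    let ?h = "\<lambda>i. hat (l $ i) (c $ i) (r $ i)"
    \<comment> \<open>Telescoping over the factors: all of them are bounded by 1, so the difference
      of the products is at most the sum of the differences of the factors.\<close>
    have "norm (tensor_hat l c r x - tensor_hat l c r y) \<le> (\<Sum>i\<in>UNIV. norm (?h i (x $ i) - ?h i (y $ i)))"
      unfolding tensor_hat_def by (rule norm_prod_diff) (simp_all add: abs_hat_le_1 lcr)
    also have "\<dots> \<le> (\<Sum>i\<in>UNIV. ?L i * dist x y)"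
    proof (rule sum_mono)
      fix i
      have "norm (?h i (x $ i) - ?h i (y $ i)) \<le> ?L i * norm (x $ i - y $ i)"
        by (rule lipschitz_on_normD[OF lipschitz_hat]) (simp_all add: lcr)
      also have "\<dots> \<le> ?L i * dist x y"
        using L component_le_norm_cart[of "x - y" i] by (intro mult_left_mono) (auto simp: dist_norm)
      finally show "norm (?h i (x $ i) - ?h i (y $ i)) \<le> ?L i * dist x y" .
    qed
    finally show "dist (tensor_hat l c r x) (tensor_hat l c r y) \<le> (\<Sum>i\<in>UNIV. ?L i) * dist x y"
      by (simp add: dist_norm sum_distrib_right)
  qed
qed

lemma AE_tensor_hat_differentiable:
  "AE x in lborel. \<exists>D. ((\<lambda>s. tensor_hat l c r (x + s *\<^sub>R axis i 1)) has_real_derivative D) (at 0)"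
  using AE_lborel_nth_noteq[where i = i and c = "l $ i"] AE_lborel_nth_noteq[where i = i and c = "c $ i"] AE_lborel_nth_noteq[where i = i and c = "r $ i"]
proof eventually_elim
  case (elim x)
  let ?h = "\<lambda>i. hat (l $ i) (c $ i) (r $ i)"
  obtain D where D: "(?h i has_real_derivative D) (at (x $ i))"
    using hat_differentiable[of "l $ i" "c $ i" "r $ i" "x $ i"] lcr elim by auto
  \<comment> \<open>Moving along axis \<open>i\<close> alters a single factor; the others form a
    constant.\<close>
  have eq: "tensor_hat l c r (x + s *\<^sub>R axis i 1) = (\<Prod>j\<in>UNIV - {i}. ?h j (x $ j)) * ?h i (s + x $ i)" for s
  proof -
    have "(\<Prod>j\<in>UNIV - {i}. ?h j ((x + s *\<^sub>R axis i 1) $ j)) = (\<Prod>j\<in>UNIV - {i}. ?h j (x $ j))"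
      by (intro prod.cong) (auto simp: axis_def)
    then show ?thesis
      by (simp add: tensor_hat_def prod.remove[of UNIV i] axis_def add.commute mult.commute)
  qed
  have "((\<lambda>s. ?h i (s + x $ i)) has_real_derivative D) (at 0)"
    using D DERIV_shift[of "?h i" D 0 "x $ i"] by simp
  from DERIV_cmult[OF this] show ?case
    unfolding eq by (rule exI)
qed

end

section \<open>Q1 polynomials and combinations of tensor hats\<close>

lemma prod_affine_in_Q1:
  assumes "\<And>x. x \<in> K \<Longrightarrow> f x = (\<Prod>i\<in>UNIV. \<alpha> i + \<beta> i * x $ i)"
  shows "\<exists>q\<in>Q1_polynomials. \<forall>x\<in>K. f x = q x"
proof -
  \<comment> \<open>Expansion of the product, with \<open>S\<close> the set of coordinates that
    contribute their linear term; this gives exactly the monomials of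
    \<open>Q1_polynomials\<close>.\<close>
  let ?q = "\<lambda>x. \<Sum>S\<in>UNIV. ((\<Prod>i\<in>S. \<beta> i) * (\<Prod>i\<in>UNIV - S. \<alpha> i)) * (\<Prod>i\<in>S. x $ i)"
  have "(\<Prod>i\<in>UNIV. \<alpha> i + \<beta> i * x $ i) = ?q x" for x :: "real^'a"
    using prod_add[of UNIV "\<lambda>i. \<beta> i * x $ i" \<alpha>]
    by (simp add: add.commute prod.distrib mult_ac)
  then show ?thesis
    using assms by (intro bexI[of _ ?q]) (auto simp: Q1_polynomials_def)
qed

lemma Q1_sum:
  assumes "\<And>k. k \<in> I \<Longrightarrow> q k \<in> Q1_polynomials"
  shows "(\<lambda>x. \<Sum>k\<in>I. c k * q k x) \<in> Q1_polynomials"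
proof -
  have "\<forall>k\<in>I. \<exists>C. \<forall>x. q k x = (\<Sum>S\<in>UNIV. C S * (\<Prod>i\<in>S. x $ i))"
    using assms by (auto simp: Q1_polynomials_def)
  then obtain C where C: "\<And>k x. k \<in> I \<Longrightarrow> q k x = (\<Sum>S\<in>UNIV. C k S * (\<Prod>i\<in>S. x $ i))"
    by metis
  have "(\<Sum>k\<in>I. c k * q k x) = (\<Sum>S\<in>UNIV. (\<Sum>k\<in>I. c k * C k S) * (\<Prod>i\<in>S. x $ i))" for x
  proof -
    have "(\<Sum>k\<in>I. c k * q k x) = (\<Sum>k\<in>I. \<Sum>S\<in>UNIV. c k * C k S * (\<Prod>i\<in>S. x $ i))"
      by (simp add: C sum_distrib_left mult_ac cong: sum.cong)
    also have "\<dots> = (\<Sum>S\<in>UNIV. (\<Sum>k\<in>I. c k * C k S) * (\<Prod>i\<in>S. x $ i))"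
      by (subst sum.swap) (simp add: sum_distrib_right)
    finally show ?thesis .
  qed
  then show ?thesis by (auto simp: Q1_polynomials_def)
qed

lemma lipschitz_on_sum:
  fixes f :: "'k \<Rightarrow> 'a::metric_space \<Rightarrow> 'b::real_normed_vector"
  assumes "\<And>k. k \<in> I \<Longrightarrow> \<exists>L. L-lipschitz_on X (f k)"
  shows "\<exists>L. L-lipschitz_on X (\<lambda>x. \<Sum>k\<in>I. f k x)"
  using assms
proof (induction I rule: infinite_finite_induct)
  case (insert k I)
  have "\<exists>L. L-lipschitz_on X (\<lambda>x. \<Sum>k\<in>I. f k x)"
    using insert.prems by (intro insert.IH) auto
  moreover have "\<exists>L. L-lipschitz_on X (f k)" using insert.prems by simp
  ultimately obtain L L' where "L-lipschitz_on X (f k)" "L'-lipschitz_on X (\<lambda>x. \<Sum>k\<in>I. f k x)"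
    by blast
  from lipschitz_on_add[OF this] show ?case using insert(1,2) by auto
qed (use lipschitz_on_constant in auto)

text \<open>Lipschitz continuity passes to finite sums, and a finite union of exceptional null sets
  is null, so the criterion \<open>lipschitz_in_H1_box\<close> applies to the combination.\<close>

lemma sum_tensor_hat_in_H1:
  fixes l c r :: "'k \<Rightarrow> real^'d" and a b :: "real^'d"
  assumes I: "finite I"
    and lcr: "\<And>k i. k \<in> I \<Longrightarrow> l k $ i < c k $ i" "\<And>k i. k \<in> I \<Longrightarrow> c k $ i < r k $ i"
  shows "(\<lambda>x. \<Sum>k\<in>I. \<gamma> k * tensor_hat (l k) (c k) (r k) x) \<in> H1 (box a b)"
proof -
  define F where "F k x = \<gamma> k * tensor_hat (l k) (c k) (r k) x" for k x
  have "\<exists>L. L-lipschitz_on UNIV (F k)" if k: "k \<in> I" for k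
  proof -
    obtain L where "L-lipschitz_on UNIV (tensor_hat (l k) (c k) (r k))"
      using lipschitz_tensor_hat[OF lcr[OF k]] by blast
    from lipschitz_on_cmult_real[OF this, of "\<gamma> k"] show ?thesis unfolding F_def by (rule exI)
  qed
  then have "\<exists>L. L-lipschitz_on UNIV (\<lambda>x. \<Sum>k\<in>I. F k x)"
    by (rule lipschitz_on_sum)
  then obtain L where L: "L-lipschitz_on UNIV (\<lambda>x. \<Sum>k\<in>I. F k x)" by (rule exE)
  have "(\<lambda>x. \<Sum>k\<in>I. F k x) \<in> H1 (box a b)"
  proof (rule lipschitz_in_H1_box[OF L])
    fix i
    have "AE x in lborel. \<forall>k\<in>I. \<exists>D. ((\<lambda>s. F k (x + s *\<^sub>R axis i 1)) has_real_derivative D) (at 0)"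
    proof (rule AE_finite_allI[OF I])
      fix k assume k: "k \<in> I"
      show "AE x in lborel. \<exists>D. ((\<lambda>s. F k (x + s *\<^sub>R axis i 1)) has_real_derivative D) (at 0)"
        using AE_tensor_hat_differentiable[OF lcr[OF k], of i]
      proof eventually_elim
        case (elim x)
        then obtain D where
          "((\<lambda>s. tensor_hat (l k) (c k) (r k) (x + s *\<^sub>R axis i 1)) has_real_derivative D) (at 0)"
          by (rule exE)
        from DERIV_cmult[OF this, of "\<gamma> k"] show ?case unfolding F_def by (rule exI)
      qed
    qed
    then show "AE x in lborel. \<exists>D. ((\<lambda>s. \<Sum>k\<in>I. F k (x + s *\<^sub>R axis i 1)) has_real_derivative D) (at 0)"
    proof eventually_elim
      case (elim x)
      then obtain D where D: "\<forall>k\<in>I. ((\<lambda>s. F k (x + s *\<^sub>R axis i 1)) has_real_derivative D k) (at 0)"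
        by (rule bchoice[THEN exE])
      have "((\<lambda>s. \<Sum>k\<in>I. F k (x + s *\<^sub>R axis i 1)) has_real_derivative (\<Sum>k\<in>I. D k)) (at 0)"
        by (rule DERIV_sum) (rule D[rule_format])
      then show ?case by (rule exI)
    qed
  qed
  then show ?thesis by (simp only: F_def)
qed

text \<open>Ties the encoding of \<open>cell_vertices\<close> by extreme points to corners: if
  coordinate \<open>i\<close> were strictly between its bounds, \<open>z\<close> would be the
  midpoint of two points of the box, shifted along axis \<open>i\<close> by the distance to the
  nearer face.\<close>

lemma extreme_point_of_cbox_cart:
  fixes z l u :: "real^'d"
  assumes z: "z extreme_point_of cbox l u"
  shows "z $ i = l $ i \<or> z $ i = u $ i"
proof (rule ccontr)
  assume neg: "\<not> ?thesis"
  have zb: "l $ j \<le> z $ j" "z $ j \<le> u $ j" for j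
    using z by (auto simp: extreme_point_of_def mem_box_cart)
  define \<delta> where "\<delta> = min (z $ i - l $ i) (u $ i - z $ i)"
  have \<delta>: "0 < \<delta>" "\<delta> \<le> z $ i - l $ i" "\<delta> \<le> u $ i - z $ i"
    using neg zb[of i] by (auto simp: \<delta>_def)
  let ?x = "z - \<delta> *\<^sub>R axis i 1" and ?y = "z + \<delta> *\<^sub>R axis i 1"
  have "l $ j \<le> ?x $ j \<and> ?x $ j \<le> u $ j \<and> l $ j \<le> ?y $ j \<and> ?y $ j \<le> u $ j" for j
    using zb[of j] \<delta> by (cases "j = i") (simp_all add: axis_def)
  then have "?x \<in> cbox l u" "?y \<in> cbox l u"
    by (simp_all only: mem_box_cart) simp_all
  moreover have "z \<in> open_segment ?x ?y"
  proof -
    have "?x $ i \<noteq> ?y $ i" using \<delta> by (simp add: axis_def)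
    then have "?x \<noteq> ?y" by metis
    moreover have "z = (1 - 1/2) *\<^sub>R ?x + (1/2) *\<^sub>R ?y"
      by (simp add: vec_eq_iff field_simps)
    ultimately show ?thesis unfolding in_segment by (intro conjI exI[of _ "1/2"]) auto
  qed
  ultimately show False using z by (auto simp: extreme_point_of_def)
qed


subsection \<open>Nodal interpolation on tensor-product meshes\<close>

context
  fixes q :: "nat \<Rightarrow> real" and M :: nat
  assumes q: "strict_mono_on {..M} q"
begin

text \<open>Beyond the end points fictitious knots at distance one complete the support of a hat.\<close>

abbreviation "knot_left k \<equiv> if k = 0 then q 0 - 1 else q (k - 1)"
abbreviation "knot_right k \<equiv> if k = M then q M + 1 else q (Suc k)"

lemma partition_less: "j < k \<Longrightarrow> k \<le> M \<Longrightarrow> q j < q k"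
  using q by (auto simp: strict_mono_on_def)

lemma partition_le: "j \<le> k \<Longrightarrow> k \<le> M \<Longrightarrow> q j \<le> q k"
  using partition_less[of j k] by (cases "j = k") auto

lemma knot_left_less: "k \<le> M \<Longrightarrow> knot_left k < q k"
  by (auto intro: partition_less)

lemma knot_right_greater: "k \<le> M \<Longrightarrow> q k < knot_right k"
  by (auto intro: partition_less)

text \<open>The Kronecker property in one dimension. If \<open>j < k\<close>, then \<open>k\<close>
  is not the first index, so the left knot is a genuine partition point and \<open>q j\<close> lies
  at or before it; symmetrically on the right.\<close>

lemma hat_at_knot:
  assumes "k \<le> M" "j \<le> M"
  shows "hat (knot_left k) (q k) (knot_right k) (q j) = (if j = k then 1 else 0)"
proof -
  note pieces = hat_pieces[OF knot_left_less[OF assms(1)] knot_right_greater[OF assms(1)]]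
  consider "j < k" | "j = k" | "k < j" by linarith
  then show ?thesis
  proof cases
    case 1
    then have "q j \<le> knot_left k" using assms partition_le[of j "k - 1"] by auto
    then show ?thesis using pieces(1) 1 by simp
  next
    case 2
    then show ?thesis
      using pieces(2)[of "q k"] knot_left_less[OF assms(1)] by simp
  next
    case 3
    then have "knot_right k \<le> q j" using assms partition_le[of "Suc k" j] by auto
    then show ?thesis using pieces(4) 3 by simp
  qed
qed

text \<open>The kinks of the hat are partition points or fictitious knots beyond the ends, so none
  is interior to a cell and the cell falls into one of the four affine pieces.\<close>

lemma hat_affine_on_cell:
  assumes "k \<le> M" "j < M"
  shows "\<exists>\<alpha> \<beta>. \<forall>x\<in>{q j..q (Suc j)}. hat (knot_left k) (q k) (knot_right k) x = \<alpha> + \<beta> * x"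
proof -
  consider "Suc j < k" | "Suc j = k" | "j = k" | "k < j" by linarith
  then have "{q j..q (Suc j)} \<subseteq> {..knot_left k} \<or> {q j..q (Suc j)} \<subseteq> {knot_left k..q k} \<or>
      {q j..q (Suc j)} \<subseteq> {q k..knot_right k} \<or> {q j..q (Suc j)} \<subseteq> {knot_right k..}"
  proof cases
    case 1
    then have "q (Suc j) \<le> knot_left k" using assms partition_le[of "Suc j" "k - 1"] by auto
    then show ?thesis by auto
  next
    case 2
    then have "knot_left k = q j" by auto
    then show ?thesis using 2 by auto
  next
    case 3
    then have "knot_right k = q (Suc j)" using assms by auto
    then show ?thesis using 3 by auto
  next
    case 4
    then have "knot_right k \<le> q j" using assms partition_le[of "Suc k" j] by auto
    then show ?thesis by auto
  qed
  then show ?thesis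
    by (rule hat_affine_on[OF knot_left_less[OF assms(1)] knot_right_greater[OF assms(1)]])
qed

end

section \<open>Cells, nodes and the interpolant\<close>

lemma tensor_product_meshE:
  assumes "tensor_product_mesh a b \<T>"
  obtains M p where
    "\<And>i. p i 0 = a $ i" "\<And>i. p i (M i) = b $ i" "\<And>i. strict_mono_on {..M i} (p i)"
    "\<T> = {cbox (\<chi> i. p i (k i)) (\<chi> i. p i (Suc (k i))) | k. \<forall>i. k i < M i}"
  using assms unfolding tensor_product_mesh_def by blast

lemma cell_vertex_coordinates:
  assumes "z \<in> cell_vertices (cbox (\<chi> i. p i (k i)) (\<chi> i. p i (Suc (k i))))" and "\<And>i. k i < M i"
  obtains k' where "\<And>i. k' i \<le> M i" "z = (\<chi> i. p i (k' i))"
proof -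
  have z: "z $ i = p i (k i) \<or> z $ i = p i (Suc (k i))" for i
    using extreme_point_of_cbox_cart[OF assms(1)[unfolded cell_vertices_def mem_Collect_eq], of i] by simp
  \<comment> \<open>Each coordinate takes the lower or the upper end of the cell; the strict bound
    on \<open>k i\<close> leaves room for the successor.\<close>
  define k' where "k' i = (if z $ i = p i (k i) then k i else Suc (k i))" for i
  have "k' i \<le> M i" for i using assms(2)[of i] by (simp add: k'_def)
  moreover have "z = (\<chi> i. p i (k' i))" using z by (auto simp: k'_def vec_eq_iff)
  ultimately show thesis by (rule that)
qed

lemma finite_bounded_index: "finite {k :: 'a::finite \<Rightarrow> nat. \<forall>i. k i \<le> M i}"
proof -
  have "{k. \<forall>i. k i \<le> M i} = PiE UNIV (\<lambda>i. {..M i})" by (auto simp: PiE_def)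
  then show ?thesis by (simp add: finite_PiE)
qed

text \<open>The witness combines nodal basis functions with the nodal values of \<open>f\<close> as
  coefficients. Nodal values follow from \<open>hat_at_knot\<close>, the Sobolev part from
  \<open>sum_tensor_hat_in_H1\<close>, the polynomial form on a cell from
  \<open>hat_affine_on_cell\<close> in each coordinate.\<close>

lemma fe_interpolant_exists:
  fixes a b :: "real^'d" and f :: "real^'d \<Rightarrow> real^3"
  assumes "tensor_product_mesh a b \<T>"
  shows "\<exists>v\<in>fe_space a b \<T>. \<forall>z\<in>mesh_nodes \<T>. v z = f z"
proof -
  obtain M p where p: "\<And>i. p i 0 = a $ i" "\<And>i. p i (M i) = b $ i" "\<And>i. strict_mono_on {..M i} (p i)"
    and \<T>: "\<T> = {cbox (\<chi> i. p i (k i)) (\<chi> i. p i (Suc (k i))) | k. \<forall>i. k i < M i}"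
    using assms by (rule tensor_product_meshE) (rule that)
  \<comment> \<open>Node indices run up to and including \<open>M i\<close>, whereas cells are
    indexed by their lower corner, strictly below \<open>M i\<close>.\<close>
  define I where "I = {k. \<forall>i. k i \<le> M i}"
  have I: "finite I" unfolding I_def by (rule finite_bounded_index)
  define node :: "('d \<Rightarrow> nat) \<Rightarrow> real^'d" where "node k = (\<chi> i. p i (k i))" for k
  define l :: "('d \<Rightarrow> nat) \<Rightarrow> real^'d" where "l k = (\<chi> i. knot_left (p i) (k i))" for k
  define r :: "('d \<Rightarrow> nat) \<Rightarrow> real^'d" where "r k = (\<chi> i. knot_right (p i) (M i) (k i))" for k
  let ?\<phi> = "\<lambda>k. tensor_hat (l k) (node k) (r k)"
  define v :: "real^'d \<Rightarrow> real^3" where "v x = (\<chi> j. \<Sum>k\<in>I. f (node k) $ j * ?\<phi> k x)" for x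
  have v: "v x $ j = (\<Sum>k\<in>I. f (node k) $ j * ?\<phi> k x)" for x j by (simp add: v_def)
  have less: "l k $ i < node k $ i" "node k $ i < r k $ i" if "k \<in> I" for k i
    using knot_left_less[OF p(3), of "k i" i] knot_right_greater[OF p(3), of "k i" i] that
    by (simp_all only: l_def r_def node_def I_def vec_lambda_beta mem_Collect_eq)
  have \<phi>: "?\<phi> k (node k') = (if k' = k then 1 else 0)" if "k \<in> I" "k' \<in> I" for k k'
  proof -
    have "?\<phi> k (node k') = (\<Prod>i\<in>UNIV. if k' i = k i then 1 else 0)"
      unfolding tensor_hat_def
    proof (rule prod.cong)
      fix i
      show "hat (l k $ i) (node k $ i) (r k $ i) (node k' $ i) = (if k' i = k i then 1 else 0)"
        using hat_at_knot[OF p(3), of "k i" i "k' i"] that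
        by (simp only: l_def r_def node_def I_def vec_lambda_beta mem_Collect_eq)
    qed simp
    also have "\<dots> = (if k' = k then 1 else 0)"
      by (auto simp: fun_eq_iff)
    finally show ?thesis .
  qed
  have "v z = f z" if z: "z \<in> mesh_nodes \<T>" for z
  proof -
    obtain k where k: "\<And>i. k i < M i"
        "z \<in> cell_vertices (cbox (\<chi> i. p i (k i)) (\<chi> i. p i (Suc (k i))))"
      using z by (auto simp: mesh_nodes_def \<T>)
    obtain k' where "\<And>i. k' i \<le> M i" "z = (\<chi> i. p i (k' i))"
      using k(2,1) by (rule cell_vertex_coordinates) (rule that)
    then have k': "k' \<in> I" "z = node k'" by (simp_all add: I_def node_def)
    have "v z $ j = f z $ j" for j
    proof -
      have "v z $ j = (\<Sum>k\<in>I. if k' = k then f (node k) $ j else 0)"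
        unfolding v by (rule sum.cong) (simp_all add: k' \<phi>)
      then show ?thesis using k' I by simp
    qed
    then show ?thesis by (simp add: vec_eq_iff)
  qed
  moreover have "v \<in> fe_space a b \<T>"
    unfolding fe_space_def
  proof (intro CollectI conjI allI ballI)
    fix j
    show "(\<lambda>x. v x $ j) \<in> H1 (box a b)"
      unfolding v by (rule sum_tensor_hat_in_H1[OF I less])
  next
    fix K j assume "K \<in> \<T>"
    then obtain k where k: "\<And>i. k i < M i" and K: "K = cbox (\<chi> i. p i (k i)) (\<chi> i. p i (Suc (k i)))"
      by (auto simp: \<T>)
    have "\<exists>q\<in>Q1_polynomials. \<forall>x\<in>K. ?\<phi> k' x = q x" if k': "k' \<in> I" for k'
    proof -
      have "\<exists>\<alpha> \<beta>. \<forall>t\<in>{p i (k i)..p i (Suc (k i))}. hat (l k' $ i) (node k' $ i) (r k' $ i) t = \<alpha> + \<beta> * t" for i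
        using hat_affine_on_cell[OF p(3), of "k' i" i "k i"] k' k
        by (simp only: l_def r_def node_def I_def vec_lambda_beta mem_Collect_eq)
      then obtain \<alpha> \<beta> where
        "\<And>i t. t \<in> {p i (k i)..p i (Suc (k i))} \<Longrightarrow> hat (l k' $ i) (node k' $ i) (r k' $ i) t = \<alpha> i + \<beta> i * t"
        by metis
      then show ?thesis
        by (intro prod_affine_in_Q1[where \<alpha> = \<alpha> and \<beta> = \<beta>])
          (auto simp: tensor_hat_def K mem_box_cart intro!: prod.cong)
    qed
    then have "\<forall>k'\<in>I. \<exists>q. q \<in> Q1_polynomials \<and> (\<forall>x\<in>K. ?\<phi> k' x = q x)" by (simp add: Bex_def)
    then obtain Q where "\<forall>k'\<in>I. Q k' \<in> Q1_polynomials \<and> (\<forall>x\<in>K. ?\<phi> k' x = Q k' x)"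
      by (rule bchoice[THEN exE])
    then have Q: "k' \<in> I \<Longrightarrow> Q k' \<in> Q1_polynomials"
        "k' \<in> I \<Longrightarrow> x \<in> K \<Longrightarrow> ?\<phi> k' x = Q k' x" for k' x
      by simp_all
    show "\<exists>q\<in>Q1_polynomials. \<forall>x\<in>K. v x $ j = q x"
    proof
      show "(\<lambda>x. \<Sum>k\<in>I. f (node k) $ j * Q k x) \<in> Q1_polynomials" by (rule Q1_sum[OF Q(1)])
      show "\<forall>x\<in>K. v x $ j = (\<Sum>k\<in>I. f (node k) $ j * Q k x)"
        unfolding v by (auto intro!: sum.cong simp: Q(2))
    qed
  qed
  ultimately show ?thesis by blast
qed

text \<open>Existence of an interpolant turns the choice in \<open>nodal_interp\<close> into its
  specification.\<close>

lemma nodal_interp_properties: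
  assumes "tensor_product_mesh a b \<T>"
  shows nodal_interp_in_fe_space: "nodal_interp a b \<T> f \<in> fe_space a b \<T>"
    and nodal_interp_at_node: "z \<in> mesh_nodes \<T> \<Longrightarrow> nodal_interp a b \<T> f z = f z"
proof -
  have "\<exists>v. v \<in> fe_space a b \<T> \<and> (\<forall>z\<in>mesh_nodes \<T>. v z = f z)"
    using fe_interpolant_exists[OF assms] by blast
  from someI_ex[OF this, folded nodal_interp_def]
  show "nodal_interp a b \<T> f \<in> fe_space a b \<T>"
    and "z \<in> mesh_nodes \<T> \<Longrightarrow> nodal_interp a b \<T> f z = f z" by blast+
qed

text \<open>Serves to evaluate \<open>m0\<close> and \<open>m\<close> at nodes, since their unit
  length is given on the closed box.\<close>

lemma mesh_nodes_subset_cbox: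
  assumes "tensor_product_mesh a b \<T>"
  shows "mesh_nodes \<T> \<subseteq> cbox a b"
proof
  fix z assume z: "z \<in> mesh_nodes \<T>"
  obtain M p where p: "\<And>i. p i 0 = a $ i" "\<And>i. p i (M i) = b $ i" "\<And>i. strict_mono_on {..M i} (p i)"
    and \<T>: "\<T> = {cbox (\<chi> i. p i (k i)) (\<chi> i. p i (Suc (k i))) | k. \<forall>i. k i < M i}"
    using assms by (rule tensor_product_meshE) (rule that)
  obtain k where k: "\<And>i. k i < M i"
      "z \<in> cell_vertices (cbox (\<chi> i. p i (k i)) (\<chi> i. p i (Suc (k i))))"
    using z by (auto simp: mesh_nodes_def \<T>)
  obtain k' where k': "\<And>i. k' i \<le> M i" "z = (\<chi> i. p i (k' i))"
    using k(2,1) by (rule cell_vertex_coordinates) (rule that)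
  have "a $ i \<le> z $ i \<and> z $ i \<le> b $ i" for i
    using partition_le[OF p(3), of 0 "k' i" i] partition_le[OF p(3), of "k' i" "M i" i] k'(1)[of i]
    by (simp add: k'(2) p(1,2))
  then show "z \<in> cbox a b" by (simp add: mem_box_cart)
qed

section \<open>The quadrature form: finiteness, positivity, separation of nodal values\<close>

lemma finite_mesh:
  assumes "tensor_product_mesh a b \<T>"
  shows "finite \<T>"
proof -
  obtain M p where p: "\<And>i. p i 0 = a $ i" "\<And>i. p i (M i) = b $ i" "\<And>i. strict_mono_on {..M i} (p i)"
    and \<T>: "\<T> = {cbox (\<chi> i. p i (k i)) (\<chi> i. p i (Suc (k i))) | k. \<forall>i. k i < M i}"
    using assms by (rule tensor_product_meshE) (rule that)
  have "\<T> \<subseteq> (\<lambda>k. cbox (\<chi> i. p i (k i)) (\<chi> i. p i (Suc (k i)))) ` {k. \<forall>i. k i \<le> M i}"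
  proof
    fix K assume "K \<in> \<T>"
    then obtain k where "\<And>i. k i < M i" and K: "K = cbox (\<chi> i. p i (k i)) (\<chi> i. p i (Suc (k i)))"
      by (auto simp: \<T>)
    then show "K \<in> (\<lambda>k. cbox (\<chi> i. p i (k i)) (\<chi> i. p i (Suc (k i)))) ` {k. \<forall>i. k i \<le> M i}"
      unfolding K by (intro image_eqI[of _ _ k]) (simp_all add: less_imp_le)
  qed
  then show ?thesis using finite_bounded_index by (rule finite_surj[rotated])
qed

text \<open>A sum over an infinite set is 0 by convention; with finitely many cells and vertices,
  \<open>inner_h\<close> is a genuine sum and its terms can be inspected one by one.\<close>

lemma finite_cell_vertices:
  assumes "tensor_product_mesh a b \<T>" "K \<in> \<T>"
  shows "finite (cell_vertices K)"
proof -
  obtain M p where p: "\<And>i. p i 0 = a $ i" "\<And>i. p i (M i) = b $ i" "\<And>i. strict_mono_on {..M i} (p i)"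
    and \<T>: "\<T> = {cbox (\<chi> i. p i (k i)) (\<chi> i. p i (Suc (k i))) | k. \<forall>i. k i < M i}"
    using assms(1) by (rule tensor_product_meshE) (rule that)
  obtain k where k: "\<And>i. k i < M i" and K: "K = cbox (\<chi> i. p i (k i)) (\<chi> i. p i (Suc (k i)))"
    using assms(2) by (auto simp: \<T>)
  have "cell_vertices K \<subseteq> (\<lambda>k. \<chi> i. p i (k i)) ` {k. \<forall>i. k i \<le> M i}"
  proof
    fix z assume "z \<in> cell_vertices K"
    then obtain k' where "\<And>i. k' i \<le> M i" "z = (\<chi> i. p i (k' i))"
      using k unfolding K by (rule cell_vertex_coordinates) (rule that)
    then show "z \<in> (\<lambda>k. \<chi> i. p i (k i)) ` {k. \<forall>i. k i \<le> M i}" by blast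
  qed
  then show ?thesis using finite_bounded_index by (rule finite_surj[rotated])
qed

lemma quad_weight_pos:
  fixes a b :: "real^'d"
  assumes "tensor_product_mesh a b \<T>" "K \<in> \<T>"
  shows "0 < quad_weight K"
proof -
  obtain M p where p: "\<And>i. p i 0 = a $ i" "\<And>i. p i (M i) = b $ i" "\<And>i. strict_mono_on {..M i} (p i)"
    and \<T>: "\<T> = {cbox (\<chi> i. p i (k i)) (\<chi> i. p i (Suc (k i))) | k. \<forall>i. k i < M i}"
    using assms(1) by (rule tensor_product_meshE) (rule that)
  obtain k where k: "\<And>i. k i < M i" and K: "K = cbox (\<chi> i. p i (k i)) (\<chi> i. p i (Suc (k i)))"
    using assms(2) by (auto simp: \<T>)
  have "0 < measure lebesgue K"
  proof -
    have less: "p i (k i) < p i (Suc (k i))" for i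
      using partition_less[OF p(3) lessI, of "k i" i] k[of i] by simp
    \<comment> \<open>The volume formula is for nonempty boxes; the lower corner is a point of the
      cell.\<close>
    then have "(\<chi> i. p i (k i)) \<in> K" by (auto simp: K mem_box_cart less_imp_le)
    then have "measure lebesgue K = (\<Prod>i\<in>UNIV. p i (Suc (k i)) - p i (k i))"
      using content_cbox_cart[of "\<chi> i. p i (k i)" "\<chi> i. p i (Suc (k i))"] by (auto simp: K)
    then show ?thesis using less by (simp add: prod_pos)
  qed
  then show ?thesis by (simp add: quad_weight_def)
qed

text \<open>A vanishing sum of nonnegative terms vanishes termwise, first over the cells, then over
  the vertices; the weight is positive and can be cancelled.\<close>

lemma inner_h_self_eq_0_imp:
  assumes \<T>: "tensor_product_mesh a b \<T>" and "inner_h \<T> v v = 0" and "z \<in> mesh_nodes \<T>"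
  shows "v z = 0"
proof -
  obtain K where K: "K \<in> \<T>" "z \<in> cell_vertices K"
    using assms(3) by (auto simp: mesh_nodes_def)
  have nonneg: "0 \<le> quad_weight K' * (v z \<bullet> v z)" if "K' \<in> \<T>" for K' z
    using quad_weight_pos[OF \<T> that] by simp
  then have "(\<Sum>z\<in>cell_vertices K. quad_weight K * (v z \<bullet> v z)) = 0"
    using assms(2) K unfolding inner_h_def
    by (subst (asm) sum_nonneg_eq_0_iff[OF finite_mesh[OF \<T>]]) (auto intro!: sum_nonneg)
  then have "quad_weight K * (v z \<bullet> v z) = 0"
    using nonneg K by (subst (asm) sum_nonneg_eq_0_iff[OF finite_cell_vertices[OF \<T> K(1)]]) auto
  then show ?thesis using quad_weight_pos[OF \<T> K(1)] by simp
qed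

lemma inner_h_cong_nodes:
  assumes "\<And>z. z \<in> mesh_nodes \<T> \<Longrightarrow> v z = v' z" "\<And>z. z \<in> mesh_nodes \<T> \<Longrightarrow> w z = w' z"
  shows "inner_h \<T> v w = inner_h \<T> v' w'"
  unfolding inner_h_def
proof (intro sum.cong refl)
  fix K z assume "K \<in> \<T>" "z \<in> cell_vertices K"
  then have "z \<in> mesh_nodes \<T>" by (auto simp: mesh_nodes_def)
  then show "quad_weight K * (v z \<bullet> w z) = quad_weight K * (v' z \<bullet> w' z)" by (simp add: assms)
qed

text \<open>\<open>F\<close> and \<open>G\<close> are arbitrary functions because the cross products
  of the scheme leave the finite element space. The interpolant of \<open>F - G\<close> is an
  admissible test function with the same nodal values, so testing with it yields the square of the
  discrete norm of the difference.\<close>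

lemma inner_h_eq_imp_nodes_eq:
  assumes \<T>: "tensor_product_mesh a b \<T>"
    and eq: "\<And>v. v \<in> fe_space a b \<T> \<Longrightarrow> inner_h \<T> F v = inner_h \<T> G v"
    and z: "z \<in> mesh_nodes \<T>"
  shows "F z = G z"
proof -
  let ?v = "nodal_interp a b \<T> (\<lambda>x. F x - G x)"
  have "inner_h \<T> ?v ?v = inner_h \<T> (\<lambda>x. F x - G x) ?v"
    by (rule inner_h_cong_nodes) (simp_all add: nodal_interp_at_node[OF \<T>])
  also have "\<dots> = inner_h \<T> F ?v - inner_h \<T> G ?v"
    by (simp add: inner_h_def inner_diff_left right_diff_distrib sum_subtractf)
  also have "\<dots> = 0"
    using eq[OF nodal_interp_in_fe_space[OF \<T>]] by simp
  finally have "?v z = 0" by (rule inner_h_self_eq_0_imp[OF \<T> _ z])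
  then show ?thesis using nodal_interp_at_node[OF \<T> z, of "\<lambda>x. F x - G x"] by simp
qed

lemma norm_h_mono:
  assumes "tensor_product_mesh a b \<T>" "\<And>z. z \<in> mesh_nodes \<T> \<Longrightarrow> norm (v z) \<le> norm (w z)"
  shows "norm_h \<T> v \<le> norm_h \<T> w"
  unfolding norm_h_def inner_h_def
proof (intro real_sqrt_le_mono sum_mono mult_left_mono)
  fix K z assume K: "K \<in> \<T>" "z \<in> cell_vertices K"
  then have "norm (v z) \<le> norm (w z)" using assms(2) by (auto simp: mesh_nodes_def)
  then show "v z \<bullet> v z \<le> w z \<bullet> w z" by (simp add: norm_le)
  show "0 \<le> quad_weight K" using quad_weight_pos[OF assms(1) K(1)] by simp
qed


subsection \<open>Nodal lengths along the scheme\<close>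

text \<open>For \<open>y\<close> of length at least 1, normalisation is the projection onto the
  closed unit ball, which is nonexpansive and fixes \<open>u\<close>. The proof compares squares
  directly.\<close>

lemma norm_sub_normalize_le:
  fixes u y :: "'a::real_inner"
  assumes u: "norm u = 1" and y: "1 \<le> norm y"
  shows "norm (u - y /\<^sub>R norm y) \<le> norm (u - y)"
proof -
  define r where "r = norm y"
  define c where "c = u \<bullet> y"
  have r: "1 \<le> r" using y by (simp add: r_def)
  have yy: "y \<bullet> y = r\<^sup>2" by (simp add: r_def power2_norm_eq_inner)
  have uu: "u \<bullet> u = 1" using u by (simp add: norm_eq_1)
  have c: "c \<le> r" unfolding c_def r_def using norm_cauchy_schwarz[of u y] u by simp
  have cr: "0 \<le> 1 - c / r" using c r by simp
  have 1: "(norm (u - y))\<^sup>2 = 1 - 2 * c + r\<^sup>2"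
    by (simp add: power2_norm_eq_inner inner_diff inner_commute uu yy c_def)
  have 2: "(norm (u - y /\<^sub>R norm y))\<^sup>2 = 2 - 2 * (c / r)"
    using r by (simp add: power2_norm_eq_inner inner_diff inner_commute uu yy c_def flip: r_def)
      (simp add: field_simps power2_eq_square)
  \<comment> \<open>The factorisation exhibits the sign: \<open>r\<close> is at least 1, and
    \<open>c / r\<close> is at most 1 by Cauchy-Schwarz.\<close>
  have "(1 - 2 * c + r\<^sup>2) - (2 - 2 * (c / r)) = (r - 1) * ((r - 1) + 2 * (1 - c / r))"
    using r by (simp add: field_simps power2_eq_square)
  moreover have "0 \<le> (r - 1) * ((r - 1) + 2 * (1 - c / r))"
    by (rule mult_nonneg_nonneg[OF _ add_nonneg_nonneg[OF _ mult_nonneg_nonneg[OF _ cr]]]) (use r in simp_all)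
  ultimately have "(norm (u - y /\<^sub>R norm y))\<^sup>2 \<le> (norm (u - y))\<^sup>2"
    unfolding 1 2 by linarith
  then show ?thesis by (rule power2_le_imp_le) simp
qed

text \<open>\<open>y - m\<close> is a multiple of \<open>cross3 m w\<close> and thus orthogonal to
  \<open>m\<close>, so the squared lengths add. In the scheme \<open>w\<close> is the whole inner
  cross product and \<open>c\<close> the time step.\<close>

lemma norm_tangential_update_ge:
  fixes m y w :: "real^3"
  assumes "(y - m) /\<^sub>R c = - cross3 m w" "c \<noteq> 0"
  shows "norm m \<le> norm y"
proof -
  have "y = m + c *\<^sub>R ((y - m) /\<^sub>R c)" using assms(2) by simp
  then have y: "y = m - c *\<^sub>R cross3 m w" by (simp add: assms(1))
  have "m \<bullet> m \<le> m \<bullet> m + (c *\<^sub>R cross3 m w) \<bullet> (c *\<^sub>R cross3 m w)"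
    by (simp only: le_add_same_cancel1 inner_ge_zero)
  also have "\<dots> = y \<bullet> y"
    by (simp add: y inner_diff inner_commute[of "cross3 m w" m] dot_cross_self)
  finally show ?thesis by (simp add: norm_le)
qed

context
  fixes a b :: "real^'d" and \<T> T N m0 mt mh
  assumes \<T>: "tensor_product_mesh a b \<T>"
    and T: "0 < T" and N: "0 < N"
    and m0: "\<And>x. x \<in> cbox a b \<Longrightarrow> norm (m0 x) = 1"
    and scheme: "scheme_solution a b \<T> T N m0 mt mh"
begin

text \<open>The tested equation becomes a vector identity at each node, once the sign has been moved
  inside the form.\<close>

lemma scheme_norm_auxiliary_ge:
  assumes "n < N" "z \<in> mesh_nodes \<T>"
  shows "norm (mh n z) \<le> norm (mt (Suc n) z)"
proof -
  let ?w = "\<lambda>x. cross3 (mh n x) (discrete_laplacian a b \<T> (mt (Suc n)) x)"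
  have "inner_h \<T> (\<lambda>x. (mt (Suc n) x - mh n x) /\<^sub>R (T / real N)) v
      = inner_h \<T> (\<lambda>x. - cross3 (mh n x) (?w x)) v" if v: "v \<in> fe_space a b \<T>" for v
    using scheme assms(1) v by (simp add: scheme_solution_def) (simp add: inner_h_def sum_negf)
  from inner_h_eq_imp_nodes_eq[OF \<T> this assms(2)]
  show ?thesis by (rule norm_tangential_update_ge) (use T N in simp_all)
qed

text \<open>Induction is needed because the lower bound on \<open>mt (Suc n)\<close> comes from the
  length of \<open>mh n\<close>; the normalisation then restores length 1.\<close>

lemma scheme_norm_projected:
  assumes "n \<le> N" "z \<in> mesh_nodes \<T>"
  shows "norm (mh n z) = 1"
  using assms
proof (induction n)
  case 0
  have "mh 0 = nodal_interp a b \<T> m0" using scheme by (simp add: scheme_solution_def)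
  then show ?case
    using 0 m0 mesh_nodes_subset_cbox[OF \<T>] by (auto simp: nodal_interp_at_node[OF \<T>])
next
  case (Suc n)
  have "mh (Suc n) = nodal_interp a b \<T> (\<lambda>x. mt (Suc n) x /\<^sub>R norm (mt (Suc n) x))"
    using scheme Suc.prems by (simp add: scheme_solution_def)
  \<comment> \<open>Excludes the zero vector, which division by its norm would send to zero instead
    of a unit vector.\<close>
  moreover have "1 \<le> norm (mt (Suc n) z)"
    using scheme_norm_auxiliary_ge[of n z] Suc by simp
  then have "mt (Suc n) z \<noteq> 0" by auto
  ultimately show ?case using Suc.prems by (simp add: nodal_interp_at_node[OF \<T>])
qed

end

theorem lemma4p7:
  fixes a b :: "real^'d"
    and \<F> :: "(real^'d) set set set" and \<T> :: "(real^'d) set set"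
    and T :: real and N n :: nat
    and m0 :: "real^'d \<Rightarrow> real^3" and m :: "real \<Rightarrow> real^'d \<Rightarrow> real^3"
    and mt mh :: "nat \<Rightarrow> real^'d \<Rightarrow> real^3"
  assumes "CARD('d) \<in> {1, 2, 3}"
    and "\<And>i. a $ i < b $ i"
    and "\<And>\<S>. \<S> \<in> \<F> \<Longrightarrow> tensor_product_mesh a b \<S>"
    and "shape_regular \<F>" and "quasi_uniform \<F>" and "\<T> \<in> \<F>"
    and "0 < T" and "0 < N"
    and "\<And>x. x \<in> cbox a b \<Longrightarrow> norm (m0 x) = 1"
    and "hmf_solution a b T m0 m"
    and "\<And>t. t \<in> {0..T} \<Longrightarrow> continuous_on (cbox a b) (m t)"
    and "\<And>t x. t \<in> {0..T} \<Longrightarrow> x \<in> cbox a b \<Longrightarrow> norm (m t x) = 1"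
    and "scheme_solution a b \<T> T N m0 mt mh"
    and "n < N"
  shows "norm_h \<T> (\<lambda>x. nodal_interp a b \<T> (m (real (Suc n) * (T / real N))) x - mh (Suc n) x)
       \<le> norm_h \<T> (\<lambda>x. nodal_interp a b \<T> (m (real (Suc n) * (T / real N))) x - mt (Suc n) x)"
proof (rule norm_h_mono)
  show \<T>: "tensor_product_mesh a b \<T>" using assms(3,6) by blast
  let ?t = "real (Suc n) * (T / real N)"
  \<comment> \<open>The new time level must lie in \<open>{0..T}\<close>, where \<open>m\<close> is
    known to have unit length.\<close>
  have "real (Suc n) \<le> real N" using \<open>n < N\<close> by linarith
  then have t: "?t \<in> {0..T}"
    using \<open>0 < T\<close> \<open>0 < N\<close> mult_right_mono[of "real (Suc n)" "real N" T] by (simp add: divide_simps mult.commute)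
  fix z assume z: "z \<in> mesh_nodes \<T>"
  have "norm (m ?t z) = 1"
    using assms(12)[OF t] z mesh_nodes_subset_cbox[OF \<T>] by blast
  moreover have "1 \<le> norm (mt (Suc n) z)"
    using scheme_norm_auxiliary_ge[OF \<T> assms(7,8,9,13,14) z]
      scheme_norm_projected[OF \<T> assms(7,8,9,13) less_imp_le[OF assms(14)] z] by simp
  moreover have "mh (Suc n) = nodal_interp a b \<T> (\<lambda>x. mt (Suc n) x /\<^sub>R norm (mt (Suc n) x))"
    using assms(13,14) by (simp add: scheme_solution_def)
  ultimately show "norm (nodal_interp a b \<T> (m ?t) z - mh (Suc n) z)
      \<le> norm (nodal_interp a b \<T> (m ?t) z - mt (Suc n) z)"
    using z by (simp only: nodal_interp_at_node[OF \<T>] norm_sub_normalize_le)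
qed

end
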